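(* Suppose that $$g.\kappa(c,b)(v)=\kappa(g.c,g.b)(g.v)$$ for all $g\in G$, $b\in B$, $c\in G.b$, and $v\in E_c$. Then the integral transform $T_\kappa\colon\Gamma(E)\to\Gamma'(F)$ is $G$-equivariant.
   Context: $G$ is a Hausdorff topological group and $B$ is a Hausdorff topological space with a continuous left action $(g,b)\mapsto g.b$; $G.b\subseteq B$ is the orbit of $b$ with the subspace topology. A $G$-equivariant real vector bundle $E\to B$ is a (finite-rank, locally trivial) real vector bundle with a continuous left $G$-action on $E$ such that the projection is $G$-equivariant and each $g\in G$ maps the fiber $E_b$ linearly to $E_{g.b}$. Let $E\to B$ and $F\to B$ be $G$-equivariant real vector bundles. $\Gamma(E)$ is the space of continuous sections of $E$, and $\Gamma'(F)$ is the space of all not necessarily continuous sections of $F$; $G$ acts on sections by $(g.f)(b):=g.f(g^{-1}.b)$. $\{\bar\mu_b\colon\mathcal B(G.b)\to[0,\infty]\}_{b\in B}$ is a family of locally finite Borel measures on the orbits with $\bar\mu_{g.b}=(g.\_)_*\bar\mu_b$ for all $g\in G$, $b\in B$ (pushforward along $c\mapsto g.c$). Let $\bigsqcup_{b\in B}G.b:=\{(c,b)\in B\times B\mid c\in G.b\}$ with the subspace topology of $B\times B$. View $E\times B$ and $B\times F$ as vector bundles over $B\times B$, so that the bundle $\mathrm{Hom}(E\times B,B\times F)\to B\times B$ has fiber $\mathrm{Hom}(E_c,F_b)$ over $(c,b)$. The kernel $\kappa\colon\bigsqcup_{b\in B}G.b\to\mathrm{Hom}(E\times B,B\times F)$ is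 a continuous map with $\kappa(c,b)\in\mathrm{Hom}(E_c,F_b)$ such that for each $b\in B$ the partial map $\kappa(-,b)$ on $G.b$ is compactly supported. The orbitwise integral transform is $T_\kappa(f)(b):=\int_{G.b}\kappa(c,b)(f(c))\,d\bar\mu_b(c)$. *)

theory Defs
  imports
    "HOL-Analysis.Analysis"
    "HOL-Algebra.Group_Action"
    "HOL-Algebra.Module"
begin

section \<open>Topological groups and continuous actions\<close>

locale topological_group = group G for G :: "('g, 'm) monoid_scheme" (structure) +
  fixes T :: "'g topology"
  assumes topspace_eq: "topspace T = carrier G"
    and continuous_mult: "continuous_map (prod_topology T T) T (\<lambda>(x, y). x \<otimes> y)"
    and continuous_inv: "continuous_map T T (\<lambda>x. inv x)"

text \<open>Following \<^locale>\<open>group_action\<close>, each \<open>\<alpha> g\<close> is a bijection of the underlying set of \<open>X\<close>,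
  extended by \<^const>\<open>undefined\<close> outside of it.\<close>

definition continuous_action ::
  "('g, 'm) monoid_scheme \<Rightarrow> 'g topology \<Rightarrow> 'x topology \<Rightarrow> ('g \<Rightarrow> 'x \<Rightarrow> 'x) \<Rightarrow> bool" where
  "continuous_action G T X \<alpha> \<longleftrightarrow>
     group_action G (topspace X) \<alpha> \<and>
     continuous_map (prod_topology T X) X (\<lambda>(g, x). \<alpha> g x)"

definition orbit_topology ::
  "('g, 'm) monoid_scheme \<Rightarrow> 'b topology \<Rightarrow> ('g \<Rightarrow> 'b \<Rightarrow> 'b) \<Rightarrow> 'b \<Rightarrow> 'b topology" where
  "orbit_topology G X \<alpha> b = subtopology X (orbit G \<alpha> b)"

definition equivariant_map ::
  "('g, 'm) monoid_scheme \<Rightarrow> ('g \<Rightarrow> 'x \<Rightarrow> 'x) \<Rightarrow> 'x set \<Rightarrow> ('g \<Rightarrow> 'y \<Rightarrow> 'y) \<Rightarrow> 'y set \<Rightarrow> ('x \<Rightarrow> 'y) \<Rightarrow> bool"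
  where
  "equivariant_map G \<alpha> A \<beta> B f \<longleftrightarrow>
     f \<in> A \<rightarrow> B \<and> (\<forall>g\<in>carrier G. \<forall>x\<in>A. f (\<alpha> g x) = \<beta> g (f x))"


section \<open>Real vector spaces as modules\<close>

text \<open>Fibres of a bundle are subsets of its total space, not types. They are therefore treated as
  modules with a carrier. The ring multiplication of such a record is irrelevant, except that
  \<open>real_line\<close> is both the field of scalars and a vector space.\<close>

definition real_line :: "(real, real) module" where
  "real_line = \<lparr>carrier = UNIV, mult = (*), one = 1, zero = 0, add = (+), smult = (*)\<rparr>"

definition real_vector_space :: "(real, 'v) module \<Rightarrow> bool" where
  "real_vector_space V \<longleftrightarrow> Module.module real_line V"

definition linear_map :: "(real, 'v) module \<Rightarrow> (real, 'w) module \<Rightarrow> ('v \<Rightarrow> 'w) \<Rightarrow> bool" where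
  "linear_map V W f \<longleftrightarrow>
     f \<in> carrier V \<rightarrow> carrier W \<and>
     (\<forall>x\<in>carrier V. \<forall>y\<in>carrier V. f (x \<oplus>\<^bsub>V\<^esub> y) = f x \<oplus>\<^bsub>W\<^esub> f y) \<and>
     (\<forall>r. \<forall>x\<in>carrier V. f (r \<odot>\<^bsub>V\<^esub> x) = r \<odot>\<^bsub>W\<^esub> f x)"

definition linear_maps :: "(real, 'v) module \<Rightarrow> (real, 'w) module \<Rightarrow> ('v \<Rightarrow> 'w) set" where
  "linear_maps V W = {f \<in> extensional (carrier V). linear_map V W f}"

definition euclidean_module :: "nat \<Rightarrow> (real, nat \<Rightarrow> real) module" where
  "euclidean_module n =
     \<lparr>carrier = topspace (Euclidean_space n), mult = undefined, one = undefined,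
      zero = (\<lambda>i. 0), add = (\<lambda>x y i. x i + y i), smult = (\<lambda>r x i. r * x i)\<rparr>"

text \<open>The integral of a function with values in a finite-dimensional real vector space, without a
  choice of coordinates. Linear functionals include all coordinate functions, so
  the condition says that \<open>h\<close> is integrable componentwise and the components of \<open>w\<close> are the
  integrals of the components of \<open>h\<close>.\<close>

definition has_vector_integral ::
  "'a measure \<Rightarrow> (real, 'v) module \<Rightarrow> ('a \<Rightarrow> 'v) \<Rightarrow> 'v \<Rightarrow> bool" where
  "has_vector_integral M V h w \<longleftrightarrow>
     w \<in> carrier V \<and> (\<forall>l. linear_map V real_line l \<longrightarrow>
       integrable M (\<lambda>x. l (h x)) \<and> l w = (LINT x|M. l (h x)))"

definition vector_integral :: "'a measure \<Rightarrow> (real, 'v) module \<Rightarrow> ('a \<Rightarrow> 'v) \<Rightarrow> 'v" where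
  "vector_integral M V h = (THE w. has_vector_integral M V h w)"


section \<open>Vector bundles\<close>

record ('b, 'e) vbundle =
  vtop :: "'e topology"
  vproj :: "'e \<Rightarrow> 'b"
  vzero :: "'b \<Rightarrow> 'e"
  vadd :: "'e \<Rightarrow> 'e \<Rightarrow> 'e"
  vscale :: "real \<Rightarrow> 'e \<Rightarrow> 'e"

definition fibre :: "('b, 'e) vbundle \<Rightarrow> 'b \<Rightarrow> (real, 'e) module" where
  "fibre E b =
     \<lparr>carrier = {e \<in> topspace (vtop E). vproj E e = b}, mult = undefined, one = undefined,
      zero = vzero E b, add = vadd E, smult = vscale E\<rparr>"

definition over :: "('b, 'e) vbundle \<Rightarrow> 'b set \<Rightarrow> 'e set" where
  "over E U = {e \<in> topspace (vtop E). vproj E e \<in> U}"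

definition local_trivialization ::
  "'b topology \<Rightarrow> ('b, 'e) vbundle \<Rightarrow> 'b set \<Rightarrow> nat \<Rightarrow> ('e \<Rightarrow> 'b \<times> (nat \<Rightarrow> real)) \<Rightarrow> bool" where
  "local_trivialization X E U n \<phi> \<longleftrightarrow>
     openin X U \<and>
     homeomorphic_map (subtopology (vtop E) (over E U))
       (prod_topology (subtopology X U) (Euclidean_space n)) \<phi> \<and>
     (\<forall>e\<in>over E U. fst (\<phi> e) = vproj E e) \<and>
     (\<forall>b\<in>U. linear_map (fibre E b) (euclidean_module n) (\<lambda>e. snd (\<phi> e)))"

definition vector_bundle :: "'b topology \<Rightarrow> ('b, 'e) vbundle \<Rightarrow> bool" where
  "vector_bundle X E \<longleftrightarrow>
     continuous_map (vtop E) X (vproj E) \<and>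
     (\<forall>b\<in>topspace X. real_vector_space (fibre E b)) \<and>
     (\<forall>b\<in>topspace X. \<exists>U n \<phi>. b \<in> U \<and> local_trivialization X E U n \<phi>)"

definition equivariant_vector_bundle ::
  "('g, 'm) monoid_scheme \<Rightarrow> 'g topology \<Rightarrow> 'b topology \<Rightarrow> ('g \<Rightarrow> 'b \<Rightarrow> 'b) \<Rightarrow>
   ('b, 'e) vbundle \<Rightarrow> ('g \<Rightarrow> 'e \<Rightarrow> 'e) \<Rightarrow> bool" where
  "equivariant_vector_bundle G T X \<alpha> E \<rho> \<longleftrightarrow>
     vector_bundle X E \<and>
     continuous_action G T (vtop E) \<rho> \<and>
     equivariant_map G \<rho> (topspace (vtop E)) \<alpha> (topspace X) (vproj E) \<and>
     (\<forall>g\<in>carrier G. \<forall>b\<in>topspace X. linear_map (fibre E b) (fibre E (\<alpha> g b)) (\<rho> g))"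

text \<open>Sections are extensional (equal to \<^const>\<open>undefined\<close> off the base), so that equality of sections
  is equality of functions.\<close>

definition all_sections :: "'b topology \<Rightarrow> ('b, 'e) vbundle \<Rightarrow> ('b \<Rightarrow> 'e) set" where
  "all_sections X E = (\<Pi>\<^sub>E b\<in>topspace X. carrier (fibre E b))"

definition continuous_sections :: "'b topology \<Rightarrow> ('b, 'e) vbundle \<Rightarrow> ('b \<Rightarrow> 'e) set" where
  "continuous_sections X E = {f \<in> all_sections X E. continuous_map X (vtop E) f}"

definition section_action ::
  "('g, 'm) monoid_scheme \<Rightarrow> 'b topology \<Rightarrow> ('g \<Rightarrow> 'b \<Rightarrow> 'b) \<Rightarrow> ('g \<Rightarrow> 'e \<Rightarrow> 'e) \<Rightarrow>
   'g \<Rightarrow> ('b \<Rightarrow> 'e) \<Rightarrow> ('b \<Rightarrow> 'e)" where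
  "section_action G X \<alpha> \<rho> g f = (\<lambda>b\<in>topspace X. \<rho> g (f (\<alpha> (inv\<^bsub>G\<^esub> g) b)))"


section \<open>Hom bundles\<close>

text \<open>A point of \<open>Hom(V, W)\<close> is a pair \<open>(x, A)\<close> with \<open>A\<close> a linear map from the fibre \<open>V\<^sub>x\<close> to \<open>W\<^sub>x\<close>.\<close>

definition hom_points ::
  "'x topology \<Rightarrow> ('x, 'v) vbundle \<Rightarrow> ('x, 'w) vbundle \<Rightarrow> ('x \<times> ('v \<Rightarrow> 'w)) set" where
  "hom_points X V W = (SIGMA x:topspace X. linear_maps (fibre V x) (fibre W x))"

text \<open>Trivializations \<open>\<phi>\<close> of \<open>V\<close> and \<open>\<psi>\<close> of \<open>W\<close> over the same \<open>U\<close> induce the chart sending \<open>(x, A)\<close>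
  to \<open>x\<close> and the \<open>n \<times> m\<close> matrix of \<open>\<psi>\<^sub>x \<circ> A \<circ> \<phi>\<^sub>x\<^sup>-\<^sup>1\<close>.\<close>

definition hom_chart ::
  "('x, 'v) vbundle \<Rightarrow> 'x set \<Rightarrow> nat \<Rightarrow> ('v \<Rightarrow> 'x \<times> (nat \<Rightarrow> real)) \<Rightarrow>
   nat \<Rightarrow> ('w \<Rightarrow> 'x \<times> (nat \<Rightarrow> real)) \<Rightarrow> 'x \<times> ('v \<Rightarrow> 'w) \<Rightarrow> 'x \<times> (nat \<times> nat \<Rightarrow> real)" where
  "hom_chart V U m \<phi> n \<psi> = (\<lambda>(x, A).
     (x, \<lambda>(i, j)\<in>{..<n} \<times> {..<m}.
           snd (\<psi> (A (inv_into (over V U) \<phi> (x, \<lambda>k. if k = j then 1 else 0)))) i))"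

definition hom_bundle ::
  "'x topology \<Rightarrow> ('x, 'v) vbundle \<Rightarrow> ('x, 'w) vbundle \<Rightarrow> ('x, 'x \<times> ('v \<Rightarrow> 'w)) vbundle" where
  "hom_bundle X V W =
     \<lparr>vtop = topology_generated_by
        {{p \<in> hom_points X V W. fst p \<in> U \<and> hom_chart V U m \<phi> n \<psi> p \<in> S} | U m \<phi> n \<psi> S.
          local_trivialization X V U m \<phi> \<and> local_trivialization X W U n \<psi> \<and>
          openin (prod_topology (subtopology X U) (powertop_real ({..<n} \<times> {..<m}))) S},
      vproj = fst,
      vzero = (\<lambda>x. (x, \<lambda>v\<in>carrier (fibre V x). vzero W x)),
      vadd = (\<lambda>(x, A) (y, A'). (x, \<lambda>v\<in>carrier (fibre V x). vadd W (A v) (A' v))),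
      vscale = (\<lambda>r (x, A). (x, \<lambda>v\<in>carrier (fibre V x). vscale W r (A v)))\<rparr>"

text \<open>\<open>E \<times> B\<close> and \<open>B \<times> F\<close> as bundles over \<open>B \<times> B\<close>; their fibres over \<open>(c, b)\<close> are
  \<open>E\<^sub>c \<times> {b}\<close> and \<open>{c} \<times> F\<^sub>b\<close>.\<close>

definition bundle_times_base ::
  "'b topology \<Rightarrow> ('b, 'e) vbundle \<Rightarrow> ('b \<times> 'b, 'e \<times> 'b) vbundle" where
  "bundle_times_base X E =
     \<lparr>vtop = prod_topology (vtop E) X, vproj = (\<lambda>(e, b). (vproj E e, b)),
      vzero = (\<lambda>(c, b). (vzero E c, b)), vadd = (\<lambda>(e, b) (e', b'). (vadd E e e', b)),
      vscale = (\<lambda>r (e, b). (vscale E r e, b))\<rparr>"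

definition base_times_bundle ::
  "'b topology \<Rightarrow> ('b, 'f) vbundle \<Rightarrow> ('b \<times> 'b, 'b \<times> 'f) vbundle" where
  "base_times_bundle X F =
     \<lparr>vtop = prod_topology X (vtop F), vproj = (\<lambda>(c, y). (c, vproj F y)),
      vzero = (\<lambda>(c, b). (c, vzero F b)), vadd = (\<lambda>(c, y) (c', y'). (c, vadd F y y')),
      vscale = (\<lambda>r (c, y). (c, vscale F r y))\<rparr>"


section \<open>Orbitwise integral transforms\<close>

definition borel_of :: "'a topology \<Rightarrow> 'a measure" where
  "borel_of X = sigma (topspace X) {U. openin X U}"

definition locally_finite_borel_measure :: "'a topology \<Rightarrow> 'a measure \<Rightarrow> bool" where
  "locally_finite_borel_measure X M \<longleftrightarrow>
     sets M = sets (borel_of X) \<and>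
     (\<forall>x\<in>topspace X. \<exists>U. openin X U \<and> x \<in> U \<and> emeasure M U < \<infinity>)"

definition equivariant_orbit_measures ::
  "('g, 'm) monoid_scheme \<Rightarrow> 'b topology \<Rightarrow> ('g \<Rightarrow> 'b \<Rightarrow> 'b) \<Rightarrow> ('b \<Rightarrow> 'b measure) \<Rightarrow> bool" where
  "equivariant_orbit_measures G X \<alpha> \<mu> \<longleftrightarrow>
     (\<forall>b\<in>topspace X. locally_finite_borel_measure (orbit_topology G X \<alpha> b) (\<mu> b)) \<and>
     (\<forall>g\<in>carrier G. \<forall>b\<in>topspace X.
        \<mu> (\<alpha> g b) = distr (\<mu> b) (borel_of (orbit_topology G X \<alpha> (\<alpha> g b))) (\<alpha> g))"

definition orbit_pairs ::
  "('g, 'm) monoid_scheme \<Rightarrow> 'b topology \<Rightarrow> ('g \<Rightarrow> 'b \<Rightarrow> 'b) \<Rightarrow> ('b \<times> 'b) set" where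
  "orbit_pairs G X \<alpha> = {(c, b) \<in> topspace X \<times> topspace X. c \<in> orbit G \<alpha> b}"

text \<open>The value \<open>\<kappa> c b\<close> is given as a linear map from \<open>E\<^sub>c\<close> to \<open>F\<^sub>b\<close>; \<open>kernel_point\<close> is the
  corresponding point of \<open>Hom(E \<times> B, B \<times> F)\<close> over \<open>(c, b)\<close>.\<close>

definition kernel_point ::
  "'b topology \<Rightarrow> ('b, 'e) vbundle \<Rightarrow> ('b \<Rightarrow> 'b \<Rightarrow> 'e \<Rightarrow> 'f) \<Rightarrow>
   'b \<times> 'b \<Rightarrow> ('b \<times> 'b) \<times> ('e \<times> 'b \<Rightarrow> 'b \<times> 'f)" where
  "kernel_point X E \<kappa> = (\<lambda>(c, b).
     ((c, b), \<lambda>(v, b')\<in>carrier (fibre (bundle_times_base X E) (c, b)). (c, \<kappa> c b v)))"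

definition orbit_kernel ::
  "('g, 'm) monoid_scheme \<Rightarrow> 'b topology \<Rightarrow> ('g \<Rightarrow> 'b \<Rightarrow> 'b) \<Rightarrow> ('b, 'e) vbundle \<Rightarrow> ('b, 'f) vbundle \<Rightarrow>
   ('b \<Rightarrow> 'b \<Rightarrow> 'e \<Rightarrow> 'f) \<Rightarrow> bool" where
  "orbit_kernel G X \<alpha> E F \<kappa> \<longleftrightarrow>
     (\<forall>(c, b)\<in>orbit_pairs G X \<alpha>. linear_map (fibre E c) (fibre F b) (\<kappa> c b)) \<and>
     continuous_map (subtopology (prod_topology X X) (orbit_pairs G X \<alpha>))
       (vtop (hom_bundle (prod_topology X X) (bundle_times_base X E) (base_times_bundle X F)))
       (kernel_point X E \<kappa>) \<and>
     (\<forall>b\<in>topspace X. compactin (orbit_topology G X \<alpha> b)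
        (orbit_topology G X \<alpha> b closure_of
           {c \<in> orbit G \<alpha> b. \<exists>v\<in>carrier (fibre E c). \<kappa> c b v \<noteq> vzero F b}))"

definition integral_transform ::
  "'b topology \<Rightarrow> ('b, 'f) vbundle \<Rightarrow> ('b \<Rightarrow> 'b measure) \<Rightarrow> ('b \<Rightarrow> 'b \<Rightarrow> 'e \<Rightarrow> 'f) \<Rightarrow>
   ('b \<Rightarrow> 'e) \<Rightarrow> ('b \<Rightarrow> 'f)" where
  "integral_transform X F \<mu> \<kappa> f =
     (\<lambda>b\<in>topspace X. vector_integral (\<mu> b) (fibre F b) (\<lambda>c. \<kappa> c b (f c)))"

end

theory Submission
  imports Defs
begin

text \<open>For a continuous section \<open>f\<close>, the integrand \<open>c \<mapsto> \<kappa> c b (f c)\<close> is continuous in the charts of the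
  Hom bundle and compactly supported, and \<open>\<mu> b\<close> is finite on compact sets. So every linear functional
  of the integrand is integrable, and since the fibre is finite-dimensional the vector integral
  exists and is unique. Equivariance is then a change of variables: \<open>\<mu> (g.a)\<close> is the image
  of \<open>\<mu> a\<close> under \<open>g\<close>, and after substituting \<open>g.c\<close> for \<open>c\<close> the integrand of \<open>g.f\<close> at \<open>g.a\<close> becomes
  \<open>g.\<kappa>(c, a)(f c)\<close>, where the linear map \<open>g\<close> can be pulled out of the integral.\<close>

section \<open>Integrals in finite-dimensional vector spaces\<close>

definition unit_vector :: "nat \<Rightarrow> nat \<Rightarrow> real" where
  "unit_vector j = (\<lambda>k. if k = j then 1 else 0)"

lemma linear_map_closed: "linear_map V W f \<Longrightarrow> x \<in> carrier V \<Longrightarrow> f x \<in> carrier W"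
  and linear_map_add: "linear_map V W f \<Longrightarrow> x \<in> carrier V \<Longrightarrow> y \<in> carrier V \<Longrightarrow>
    f (x \<oplus>\<^bsub>V\<^esub> y) = f x \<oplus>\<^bsub>W\<^esub> f y"
  and linear_map_scale: "linear_map V W f \<Longrightarrow> x \<in> carrier V \<Longrightarrow> f (r \<odot>\<^bsub>V\<^esub> x) = r \<odot>\<^bsub>W\<^esub> f x"
  by (auto simp: linear_map_def)

lemma linear_map_compose:
  assumes "linear_map V W f" "linear_map W Z g"
  shows "linear_map V Z (\<lambda>x. g (f x))"
  using assms unfolding linear_map_def by (auto simp: Pi_iff)

lemma real_line_simps [simp]:
  "carrier real_line = UNIV" "zero real_line = 0" "add real_line = (+)" "smult real_line = (*)"
  by (auto simp: real_line_def)

lemma euclidean_module_simps [simp]: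
  "carrier (euclidean_module n) = topspace (Euclidean_space n)"
  "add (euclidean_module n) = (\<lambda>x y i. x i + y i)"
  "smult (euclidean_module n) = (\<lambda>r x i. r * x i)"
  by (auto simp: euclidean_module_def)

lemma fibre_simps [simp]:
  "carrier (fibre E b) = {e \<in> topspace (vtop E). vproj E e = b}"
  "zero (fibre E b) = vzero E b" "add (fibre E b) = vadd E" "smult (fibre E b) = vscale E"
  by (auto simp: fibre_def)

lemma
  assumes "real_vector_space V"
  shows vector_space_add_closed: "x \<in> carrier V \<Longrightarrow> y \<in> carrier V \<Longrightarrow> x \<oplus>\<^bsub>V\<^esub> y \<in> carrier V"
    and vector_space_scale_closed: "x \<in> carrier V \<Longrightarrow> r \<odot>\<^bsub>V\<^esub> x \<in> carrier V"
    and vector_space_zero_closed: "\<zero>\<^bsub>V\<^esub> \<in> carrier V"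
    and vector_space_scale_zero: "x \<in> carrier V \<Longrightarrow> 0 \<odot>\<^bsub>V\<^esub> x = \<zero>\<^bsub>V\<^esub>"
proof -
  interpret Module.module real_line V
    using assms by (simp add: real_vector_space_def)
  show "x \<in> carrier V \<Longrightarrow> y \<in> carrier V \<Longrightarrow> x \<oplus>\<^bsub>V\<^esub> y \<in> carrier V" by simp
  show "x \<in> carrier V \<Longrightarrow> r \<odot>\<^bsub>V\<^esub> x \<in> carrier V" by simp
  show "\<zero>\<^bsub>V\<^esub> \<in> carrier V" by simp
  show "x \<in> carrier V \<Longrightarrow> 0 \<odot>\<^bsub>V\<^esub> x = \<zero>\<^bsub>V\<^esub>" using smult_l_null[of x] by simp
qed

lemma linear_functional_zero:
  assumes V: "real_vector_space V" and l: "linear_map V real_line l"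
  shows "l (\<zero>\<^bsub>V\<^esub>) = 0"
  using linear_map_scale[OF l vector_space_zero_closed[OF V], of 0]
    vector_space_scale_zero[OF V vector_space_zero_closed[OF V]] by simp

text \<open>Induction over the truncation of \<open>x\<close> to its first \<open>k\<close>
  coordinates: each step adds a multiple of one basis vector. Points of
  \<open>Euclidean_space n\<close> vanish from index \<open>n\<close> on, so the truncation at
  \<open>n\<close> is \<open>x\<close> itself.\<close>

lemma linear_functional_euclidean:
  assumes l: "linear_map (euclidean_module n) real_line l" and x: "x \<in> topspace (Euclidean_space n)"
  shows "l x = (\<Sum>i<n. x i * l (unit_vector i))"
proof -
  have "l (\<lambda>i. if i < k then x i else 0) = (\<Sum>i<k. x i * l (unit_vector i))" if "k \<le> n" for k
    using that
  proof (induction k)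
    case 0
    then show ?case
      using linear_map_scale[OF l, of "\<lambda>i. 0" 0] by (simp add: topspace_Euclidean_space)
  next
    case (Suc k)
    have "l (\<lambda>i. if i < Suc k then x i else 0)
        = l (\<lambda>i. (if i < k then x i else 0) + x k * unit_vector k i)"
      by (rule arg_cong[of _ _ l]) (auto simp: unit_vector_def fun_eq_iff less_Suc_eq)
    also have "\<dots> = l (\<lambda>i. if i < k then x i else 0) + x k * l (unit_vector k)"
    proof -
      have "(\<lambda>i. if i < k then x i else 0) \<in> topspace (Euclidean_space n)"
        "(\<lambda>i. x k * unit_vector k i) \<in> topspace (Euclidean_space n)"
        "unit_vector k \<in> topspace (Euclidean_space n)"
        using Suc.prems by (auto simp: topspace_Euclidean_space unit_vector_def)
      then show ?thesis
        using linear_map_add[OF l, of "\<lambda>i. if i < k then x i else 0" "\<lambda>i. x k * unit_vector k i"]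
          linear_map_scale[OF l, of "unit_vector k" "x k"] by simp
    qed
    finally show ?case using Suc by simp
  qed
  moreover have "(\<lambda>i. if i < n then x i else 0) = x"
    using x by (auto simp: topspace_Euclidean_space fun_eq_iff)
  ultimately show ?thesis by force
qed

text \<open>Sums and multiples in \<open>W\<close> are images under \<open>f\<close> of sums and
  multiples of preimages. Since \<open>V\<close> is closed under both operations, cancelling
  \<open>f\<close> carries them through the inverse.\<close>

lemma linear_map_inv_into:
  assumes V: "real_vector_space V" and f: "linear_map V W f" and bij: "bij_betw f (carrier V) (carrier W)"
  shows "linear_map W V (inv_into (carrier V) f)"
proof -
  let ?g = "inv_into (carrier V) f"
  have g: "?g y \<in> carrier V" "f (?g y) = y" if "y \<in> carrier W" for y
    using that bij by (auto simp: bij_betw_def inv_into_into f_inv_into_f)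
  have gf: "?g (f x) = x" if "x \<in> carrier V" for x
    using that bij by (auto simp: bij_betw_def)
  have "?g (y \<oplus>\<^bsub>W\<^esub> z) = ?g y \<oplus>\<^bsub>V\<^esub> ?g z" if "y \<in> carrier W" "z \<in> carrier W" for y z
    using gf[OF vector_space_add_closed[OF V g(1)[OF that(1)] g(1)[OF that(2)]]]
    by (simp add: linear_map_add[OF f] g that)
  moreover have "?g (r \<odot>\<^bsub>W\<^esub> y) = r \<odot>\<^bsub>V\<^esub> ?g y" if "y \<in> carrier W" for y r
    using gf[OF vector_space_scale_closed[OF V g(1)[OF that(1)]], of r]
    by (simp add: linear_map_scale[OF f] g that)
  ultimately show ?thesis
    using g by (auto simp: linear_map_def)
qed

text \<open>The preimages of the unit vectors under the coordinates \<open>f\<close> form a basis of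
  \<open>V\<close>. The expansion is the Euclidean one applied to \<open>l\<close> composed with the
  inverse of \<open>f\<close>.\<close>

lemma linear_functional_expand:
  assumes V: "real_vector_space V" and f: "linear_map V (euclidean_module n) f"
    and bij: "bij_betw f (carrier V) (topspace (Euclidean_space n))"
    and l: "linear_map V real_line l" and v: "v \<in> carrier V"
  shows "l v = (\<Sum>i<n. f v i * l (inv_into (carrier V) f (unit_vector i)))"
proof -
  have "linear_map (euclidean_module n) real_line (\<lambda>x. l (inv_into (carrier V) f x))"
    using linear_map_inv_into[OF V f] bij l by (auto intro!: linear_map_compose[of _ V])
  from linear_functional_euclidean[OF this, of "f v"] show ?thesis
    using bij v by (auto simp: bij_betw_def)
qed

section \<open>Existence, uniqueness and naturality of the vector integral\<close>

lemma linear_coordinate: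
  assumes "linear_map V (euclidean_module n) f"
  shows "linear_map V real_line (\<lambda>v. f v i)"
  using assms by (auto simp: linear_map_def)

text \<open>Stated by global linear coordinates, which is the form in which a local trivialization
  provides them on each fibre.\<close>

definition finite_dimensional :: "(real, 'v) module \<Rightarrow> bool" where
  "finite_dimensional V \<longleftrightarrow> real_vector_space V \<and>
     (\<exists>n f. linear_map V (euclidean_module n) f \<and> bij_betw f (carrier V) (topspace (Euclidean_space n)))"

text \<open>Each coordinate of \<open>f\<close> is itself a linear functional, so the defining
  condition fixes all coordinates of the integral, and \<open>f\<close> is injective.\<close>

lemma has_vector_integral_unique:
  assumes V: "finite_dimensional V" and w: "has_vector_integral M V h w" "has_vector_integral M V h w'"
  shows "w = w'"
proof -
  obtain n f where f: "linear_map V (euclidean_module n) f"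
      "bij_betw f (carrier V) (topspace (Euclidean_space n))"
    using V by (auto simp: finite_dimensional_def)
  have "f w i = f w' i" for i
    using w linear_coordinate[OF f(1), of i] unfolding has_vector_integral_def by metis
  then have "f w = f w'" by blast
  then show ?thesis
    using w f(2) by (auto simp: has_vector_integral_def bij_betw_def dest: inj_onD)
qed

lemma vector_integral_eq:
  assumes "finite_dimensional V" "has_vector_integral M V h w"
  shows "vector_integral M V h = w"
  unfolding vector_integral_def
  using assms has_vector_integral_unique by (metis the_equality)

text \<open>The integral is the vector whose coordinates are the integrals of the coordinates of
  \<open>h\<close>. Any other functional is a finite linear combination of coordinates, so linearity
  of the real integral covers it.\<close>

lemma has_vector_integral_exists:
  assumes V: "finite_dimensional V" and h: "h \<in> space M \<rightarrow> carrier V"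
    and int: "\<And>l. linear_map V real_line l \<Longrightarrow> integrable M (\<lambda>x. l (h x))"
  shows "has_vector_integral M V h (vector_integral M V h)"
proof -
  obtain n f where f: "linear_map V (euclidean_module n) f"
      "bij_betw f (carrier V) (topspace (Euclidean_space n))" and V': "real_vector_space V"
    using V by (auto simp: finite_dimensional_def)
  define x where "x = (\<lambda>i. LINT c|M. f (h c) i)"
  \<comment> \<open>The vector of integrals must again vanish from index \<open>n\<close> on to be a
    point of \<open>Euclidean_space n\<close>; there the integrand is already zero.\<close>
  have "f (h c) i = 0" if "c \<in> space M" "n \<le> i" for c i
    using linear_map_closed[OF f(1), of "h c"] h that by (auto simp: topspace_Euclidean_space)
  then have x: "x \<in> topspace (Euclidean_space n)"
    unfolding x_def topspace_Euclidean_space by (auto intro!: Bochner_Integration.integral_eq_zero_AE)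
  define w where "w = inv_into (carrier V) f x"
  have w: "w \<in> carrier V" "f w = x"
    using x f(2) by (auto simp: w_def bij_betw_def inv_into_into f_inv_into_f)
  have "l w = (LINT c|M. l (h c))" if l: "linear_map V real_line l" for l
  proof -
    have "(LINT c|M. l (h c)) = (LINT c|M. (\<Sum>i<n. f (h c) i * l (inv_into (carrier V) f (unit_vector i))))"
      using h by (intro Bochner_Integration.integral_cong refl linear_functional_expand[OF V' f l]) auto
    also have "\<dots> = (\<Sum>i<n. x i * l (inv_into (carrier V) f (unit_vector i)))"
      unfolding x_def using int[OF linear_coordinate[OF f(1)]]
      by (subst Bochner_Integration.integral_sum) auto
    also have "\<dots> = l w"
      using linear_functional_expand[OF V' f l w(1)] w(2) by simp
    finally show ?thesis ..
  qed
  then have "has_vector_integral M V h w"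
    using w int by (auto simp: has_vector_integral_def)
  then show ?thesis using vector_integral_eq[OF V] by metis
qed

text \<open>A functional on \<open>W\<close> pulls back along \<open>A\<close> to a functional on
  \<open>V\<close>, and the condition for \<open>V\<close> is tested on that pullback.\<close>

lemma has_vector_integral_linear:
  assumes "has_vector_integral M V h w" "linear_map V W A"
  shows "has_vector_integral M W (\<lambda>x. A (h x)) (A w)"
  using assms linear_map_compose[OF assms(2)] unfolding has_vector_integral_def
  by (auto intro: linear_map_closed)

lemma has_vector_integral_distr:
  assumes "t \<in> measurable M N" "has_vector_integral (distr M N t) V h w"
  shows "has_vector_integral M V (\<lambda>x. h (t x)) w"
  unfolding has_vector_integral_def
proof (intro conjI allI impI)
  show "w \<in> carrier V" using assms(2) by (simp add: has_vector_integral_def)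
  fix l :: "'c \<Rightarrow> real" assume "linear_map V real_line l"
  then have l: "integrable (distr M N t) (\<lambda>x. l (h x))" "l w = (LINT x|distr M N t. l (h x))"
    using assms(2) by (auto simp: has_vector_integral_def)
  \<comment> \<open>The transformation rule asks for measurability over \<open>N\<close>. It is
    contained in integrability over the image measure, which has the sigma-algebra of
    \<open>N\<close>.\<close>
  then have "(\<lambda>x. l (h x)) \<in> borel_measurable N"
    using borel_measurable_integrable by fastforce
  then show "integrable M (\<lambda>x. l (h (t x)))" "l w = (LINT x|M. l (h (t x)))"
    using l integrable_distr[OF assms(1) l(1)] integral_distr[OF assms(1), of "\<lambda>x. l (h x)"] by auto
qed

lemma has_vector_integral_cong:
  assumes "has_vector_integral M V h w" "\<And>x. x \<in> space M \<Longrightarrow> h x = h' x"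
  shows "has_vector_integral M V h' w"
proof -
  have "integrable M (\<lambda>x. l (h' x)) = integrable M (\<lambda>x. l (h x))"
    "(LINT x|M. l (h' x)) = (LINT x|M. l (h x))" for l :: "'b \<Rightarrow> real"
    using assms(2) by (auto intro!: Bochner_Integration.integrable_cong Bochner_Integration.integral_cong)
  then show ?thesis using assms(1) by (simp add: has_vector_integral_def)
qed

section \<open>Borel measures of topological spaces\<close>

lemma space_borel_of [simp]: "space (borel_of X) = topspace X"
  and sets_borel_of: "sets (borel_of X) = sigma_sets (topspace X) {U. openin X U}"
  unfolding borel_of_def by (auto intro!: space_measure_of sets_measure_of dest: openin_subset)

lemma openin_sets_borel_of: "openin X U \<Longrightarrow> U \<in> sets (borel_of X)"
  by (auto simp: sets_borel_of)

lemma closedin_sets_borel_of: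
  assumes "closedin X K"
  shows "K \<in> sets (borel_of X)"
proof -
  have "K = space (borel_of X) - (topspace X - K)"
    using closedin_subset[OF assms] by auto
  also have "\<dots> \<in> sets (borel_of X)"
    using assms by (intro sets.compl_sets openin_sets_borel_of) (auto simp: closedin_def)
  finally show ?thesis .
qed

lemma measurable_borel_of:
  assumes "continuous_map X Y f"
  shows "f \<in> measurable (borel_of X) (borel_of Y)"
  unfolding borel_of_def[of Y]
proof (rule measurable_measure_of)
  show "{U. openin Y U} \<subseteq> Pow (topspace Y)" by (auto dest: openin_subset)
  show "f \<in> space (borel_of X) \<rightarrow> topspace Y" using assms by (auto simp: continuous_map_def)
  fix A assume "A \<in> {U. openin Y U}"
  then have "openin X {x \<in> topspace X. f x \<in> A}"
    using assms by (auto simp: continuous_map_def)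
  then show "f -` A \<inter> space (borel_of X) \<in> sets (borel_of X)"
    by (auto intro!: openin_sets_borel_of simp: vimage_def Int_def conj_commute)
qed

lemma borel_of_euclidean: "borel_of euclidean = borel"
  unfolding borel_of_def borel_def by simp

text \<open>Finitely many open sets of finite measure cover \<open>K\<close>, so \<open>K\<close>
  has finite measure; closedness makes \<open>K\<close> a Borel set. On \<open>K\<close> the
  function is bounded because its image is compact, and elsewhere it is zero.\<close>

lemma integrable_continuous_compact_support:
  fixes u :: "'a \<Rightarrow> real"
  assumes M: "locally_finite_borel_measure X M" and u: "continuous_map X euclideanreal u"
    and K: "compactin X K" "closedin X K" and z: "\<And>x. x \<in> topspace X - K \<Longrightarrow> u x = 0"
  shows "integrable M u"
proof -
  have sets: "sets M = sets (borel_of X)" using M by (simp add: locally_finite_borel_measure_def)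
  then have space: "space M = topspace X" using sets_eq_imp_space_eq[OF sets] by simp
  have "\<exists>U. \<forall>x\<in>K. openin X (U x) \<and> x \<in> U x \<and> emeasure M (U x) < \<infinity>"
    using M compactin_subset_topspace[OF K(1)]
    unfolding locally_finite_borel_measure_def by (intro bchoice) auto
  then obtain U where U: "\<And>x. x \<in> K \<Longrightarrow> openin X (U x)" "\<And>x. x \<in> K \<Longrightarrow> x \<in> U x"
      "\<And>x. x \<in> K \<Longrightarrow> emeasure M (U x) < \<infinity>"
    by blast
  have "\<exists>\<F>. finite \<F> \<and> \<F> \<subseteq> U ` K \<and> K \<subseteq> \<Union>\<F>"
    using K(1) U(1,2) unfolding compactin_def by (elim conjE allE[of _ "U ` K"]) blast
  then obtain I where I: "finite I" "I \<subseteq> K" "K \<subseteq> (\<Union>x\<in>I. U x)"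
    by (metis finite_subset_image)
  have Usets: "U x \<in> sets M" if "x \<in> I" for x
    using U(1) I(2) that by (auto simp: sets openin_sets_borel_of)
  have "emeasure M K \<le> emeasure M (\<Union>x\<in>I. U x)"
    using I Usets by (intro emeasure_mono) auto
  also have "\<dots> \<le> (\<Sum>x\<in>I. emeasure M (U x))"
    using I Usets by (intro emeasure_subadditive_finite) auto
  also have "\<dots> < \<infinity>" using I U(3) by (auto simp: ennreal_sum_less_top)
  finally have fin: "emeasure M K < \<infinity>" .
  have "compact (u ` K)"
    using image_compactin[OF K(1) u] by simp
  then obtain C where C: "\<And>x. x \<in> K \<Longrightarrow> norm (u x) \<le> C"
    using compact_imp_bounded bounded_iff by (metis imageI)
  show ?thesis
  proof (rule integrableI_bounded_set)
    show "K \<in> sets M" using K(2) by (simp add: sets closedin_sets_borel_of)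
    show "u \<in> borel_measurable M"
      using measurable_borel_of[OF u] by (simp add: borel_of_euclidean measurable_cong_sets[OF sets refl])
  qed (use fin C z space in auto)
qed

section \<open>Local trivializations\<close>

lemma trivialization_bij_betw:
  assumes triv: "local_trivialization X E U n \<phi>"
  shows "bij_betw \<phi> (over E U) (U \<times> topspace (Euclidean_space n))"
proof -
  have "U \<subseteq> topspace X" and h: "homeomorphic_map (subtopology (vtop E) (over E U))
      (prod_topology (subtopology X U) (Euclidean_space n)) \<phi>"
    using triv by (auto simp: local_trivialization_def dest: openin_subset)
  moreover have "over E U \<subseteq> topspace (vtop E)" by (auto simp: over_def)
  ultimately show ?thesis
    using h unfolding homeomorphic_eq_everything_map by (simp add: bij_betw_def inf.absorb2)
qed

lemma trivialization_fst:
  assumes "local_trivialization X E U n \<phi>" "e \<in> over E U"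
  shows "fst (\<phi> e) = vproj E e"
  using assms by (auto simp: local_trivialization_def)

lemma trivialization_continuous:
  assumes "local_trivialization X E U n \<phi>"
  shows "continuous_map (subtopology (vtop E) (over E U)) (Euclidean_space n) (\<lambda>e. snd (\<phi> e))"
  using assms homeomorphic_imp_continuous_map continuous_map_compose[OF _ continuous_map_snd]
  unfolding local_trivialization_def comp_def by blast

lemma trivialization_linear:
  assumes "local_trivialization X E U n \<phi>" "b \<in> U"
  shows "linear_map (fibre E b) (euclidean_module n) (\<lambda>e. snd (\<phi> e))"
  using assms by (auto simp: local_trivialization_def)

lemma trivialization_inv:
  assumes triv: "local_trivialization X E U n \<phi>" and b: "b \<in> U" and x: "x \<in> topspace (Euclidean_space n)"
  shows "inv_into (over E U) \<phi> (b, x) \<in> carrier (fibre E b)"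
    and "\<phi> (inv_into (over E U) \<phi> (b, x)) = (b, x)"
proof -
  have "(b, x) \<in> \<phi> ` over E U"
    using trivialization_bij_betw[OF triv] b x by (auto simp: bij_betw_def)
  then have over: "inv_into (over E U) \<phi> (b, x) \<in> over E U"
    and eq: "\<phi> (inv_into (over E U) \<phi> (b, x)) = (b, x)"
    by (auto intro: inv_into_into f_inv_into_f)
  show "inv_into (over E U) \<phi> (b, x) \<in> carrier (fibre E b)"
    using trivialization_fst[OF triv over] over eq by (simp add: over_def)
  show "\<phi> (inv_into (over E U) \<phi> (b, x)) = (b, x)" by (rule eq)
qed

text \<open>The first component of \<phi> is the projection, hence constant on a fibre. Fixing
  \<open>b\<close> there in the inverse of \<phi> inverts the second component.\<close>

lemma trivialization_fibre_bij_betw: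
  assumes triv: "local_trivialization X E U n \<phi>" and b: "b \<in> U"
  shows "bij_betw (\<lambda>e. snd (\<phi> e)) (carrier (fibre E b)) (topspace (Euclidean_space n))"
proof (rule bij_betw_byWitness[where f' = "\<lambda>x. inv_into (over E U) \<phi> (b, x)"])
  have sub: "carrier (fibre E b) \<subseteq> over E U" using b by (auto simp: over_def)
  show "\<forall>e\<in>carrier (fibre E b). inv_into (over E U) \<phi> (b, snd (\<phi> e)) = e"
  proof
    fix e assume e: "e \<in> carrier (fibre E b)"
    then have "\<phi> e = (b, snd (\<phi> e))"
      using trivialization_fst[OF triv, of e] sub by (auto simp: prod_eq_iff)
    then show "inv_into (over E U) \<phi> (b, snd (\<phi> e)) = e"
      using trivialization_bij_betw[OF triv] e sub
      by (metis bij_betw_def inv_into_f_f subsetD)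
  qed
  show "(\<lambda>e. snd (\<phi> e)) ` carrier (fibre E b) \<subseteq> topspace (Euclidean_space n)"
    using linear_map_closed[OF trivialization_linear[OF triv b]] by auto
qed (use trivialization_inv[OF triv b] in auto)

text \<open>The local frame of \<open>E\<close> over \<open>U\<close> given by \<phi>. It is written
  with the same \<open>inv_into\<close> as \<open>hom_chart\<close>, so that the matrix entries of a
  chart are coordinates of images of frame vectors.\<close>

definition frame :: "('b, 'e) vbundle \<Rightarrow> 'b set \<Rightarrow> ('e \<Rightarrow> 'b \<times> (nat \<Rightarrow> real)) \<Rightarrow> 'b \<Rightarrow> nat \<Rightarrow> 'e" where
  "frame E U \<phi> b j = inv_into (over E U) \<phi> (b, unit_vector j)"

lemma unit_vector_Euclidean: "j < n \<Longrightarrow> unit_vector j \<in> topspace (Euclidean_space n)"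
  by (auto simp: unit_vector_def topspace_Euclidean_space)

lemma frame_carrier:
  assumes "local_trivialization X E U n \<phi>" "b \<in> U" "j < n"
  shows "frame E U \<phi> b j \<in> carrier (fibre E b)"
  unfolding frame_def using trivialization_inv(1)[OF assms(1,2)] unit_vector_Euclidean[OF assms(3)] .

lemma linear_functional_frame:
  assumes E: "real_vector_space (fibre E b)" and triv: "local_trivialization X E U n \<phi>" and b: "b \<in> U"
    and l: "linear_map (fibre E b) real_line l" and e: "e \<in> carrier (fibre E b)"
  shows "l e = (\<Sum>j<n. snd (\<phi> e) j * l (frame E U \<phi> b j))"
proof -
  let ?f = "\<lambda>e. snd (\<phi> e)"
  note bij = trivialization_fibre_bij_betw[OF triv b]
  \<comment> \<open>The expansion inverts the coordinates on a single fibre, whereas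
    \<open>frame\<close> inverts \<phi> on all of \<open>over E U\<close>. Both give the unique
    vector of the fibre with coordinates \<open>unit_vector j\<close>.\<close>
  have "inv_into (carrier (fibre E b)) ?f (unit_vector j) = frame E U \<phi> b j" if "j < n" for j
  proof (rule inv_into_f_eq)
    show "inj_on ?f (carrier (fibre E b))" using bij by (auto simp: bij_betw_def)
    show "frame E U \<phi> b j \<in> carrier (fibre E b)" by (rule frame_carrier[OF triv b that])
    show "?f (frame E U \<phi> b j) = unit_vector j"
      using trivialization_inv(2)[OF triv b unit_vector_Euclidean[OF that]] by (simp add: frame_def)
  qed
  then show ?thesis
    using linear_functional_expand[OF E trivialization_linear[OF triv b] bij l e] by simp
qed

lemma vector_bundle_fibre:
  assumes "vector_bundle X E" "b \<in> topspace X"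
  shows "real_vector_space (fibre E b)" "finite_dimensional (fibre E b)"
proof -
  show V: "real_vector_space (fibre E b)" using assms by (simp add: vector_bundle_def)
  obtain U n \<phi> where b: "b \<in> U" and triv: "local_trivialization X E U n \<phi>"
    using assms unfolding vector_bundle_def by meson
  show "finite_dimensional (fibre E b)"
    unfolding finite_dimensional_def
    using V trivialization_linear[OF triv b] trivialization_fibre_bij_betw[OF triv b] by (intro conjI exI)
qed

section \<open>Trivializations of the two product bundles and charts of the Hom bundle\<close>

lemma continuous_map_fst_comp: "continuous_map Z (prod_topology X Y) f \<Longrightarrow> continuous_map Z X (\<lambda>z. fst (f z))"
  and continuous_map_snd_comp: "continuous_map Z (prod_topology X Y) f \<Longrightarrow> continuous_map Z Y (\<lambda>z. snd (f z))"
  using continuous_map_fst_of continuous_map_snd_of unfolding comp_def by blast+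

text \<open>A Hom chart needs trivializations of \<open>E \<times> B\<close> and
  \<open>B \<times> F\<close> over one common open subset of \<open>B \<times> B\<close>. The extra
  factor \<open>V\<close> leaves room for a set over which \<open>F\<close> is trivial.\<close>

lemma trivialization_bundle_times_base:
  assumes triv: "local_trivialization X E U n \<phi>" and V: "openin X V"
  shows "local_trivialization (prod_topology X X) (bundle_times_base X E) (U \<times> V) n
           (\<lambda>(e, b). ((vproj E e, b), snd (\<phi> e)))"
proof -
  let ?EU = "subtopology (vtop E) (over E U)" and ?R = "Euclidean_space n"
  have U: "openin X U" using triv by (simp add: local_trivialization_def)
  have sub: "U \<subseteq> topspace X" "V \<subseteq> topspace X" using U V by (auto dest: openin_subset)
  obtain \<phi>' where h: "homeomorphic_maps ?EU (prod_topology (subtopology X U) ?R) \<phi> \<phi>'"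
    using triv unfolding local_trivialization_def homeomorphic_map_maps by blast
  have c: "continuous_map ?EU (prod_topology (subtopology X U) ?R) \<phi>"
    and c': "continuous_map (prod_topology (subtopology X U) ?R) ?EU \<phi>'"
    using h by (auto simp: homeomorphic_maps_def)
  have top_EU: "topspace ?EU = over E U" by (auto simp: over_def)
  have "\<forall>e\<in>over E U. \<phi>' (\<phi> e) = e"
    and "\<forall>p\<in>U \<times> topspace ?R. \<phi> (\<phi>' p) = p"
    and "\<phi>' ` (U \<times> topspace ?R) \<subseteq> over E U"
    using h sub continuous_map_image_subset_topspace[OF c']
    unfolding homeomorphic_maps_def top_EU by (simp_all add: inf.absorb2)
  then have inv: "\<And>e. e \<in> over E U \<Longrightarrow> \<phi>' (\<phi> e) = e"
    and inv': "\<And>b x. b \<in> U \<Longrightarrow> x \<in> topspace ?R \<Longrightarrow> \<phi> (\<phi>' (b, x)) = (b, x)"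
      "\<And>b x. b \<in> U \<Longrightarrow> x \<in> topspace ?R \<Longrightarrow> \<phi>' (b, x) \<in> over E U"
    by auto
  \<comment> \<open>Writing the projection as a component of \<phi> lets continuity of the new
    trivialization follow from that of \<phi> alone.\<close>
  have proj: "vproj E e = fst (\<phi> e)" if "e \<in> over E U" for e
    using trivialization_fst[OF triv that] by simp
  have over: "over (bundle_times_base X E) (U \<times> V) = over E U \<times> V"
    using sub by (auto simp: over_def bundle_times_base_def)
  have "homeomorphic_maps (prod_topology ?EU (subtopology X V))
      (prod_topology (prod_topology (subtopology X U) (subtopology X V)) ?R)
      (\<lambda>(e, b). ((vproj E e, b), snd (\<phi> e))) (\<lambda>((c, b), x). (\<phi>' (c, x), b))"
    unfolding homeomorphic_maps_def
  proof (intro conjI ballI)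
    have 1: "continuous_map (prod_topology ?EU (subtopology X V)) (prod_topology (subtopology X U) ?R) (\<lambda>p. \<phi> (fst p))"
      using continuous_map_compose[OF continuous_map_fst c] by (simp add: comp_def)
    have 2: "continuous_map (prod_topology (prod_topology (subtopology X U) (subtopology X V)) ?R)
        (prod_topology (subtopology X U) ?R) (\<lambda>p. (fst (fst p), snd p))"
      by (intro continuous_map_pairedI continuous_map_snd continuous_map_fst_comp[OF continuous_map_fst])
    have "continuous_map (prod_topology ?EU (subtopology X V))
      (prod_topology (prod_topology (subtopology X U) (subtopology X V)) ?R)
      (\<lambda>p. ((fst (\<phi> (fst p)), snd p), snd (\<phi> (fst p))))"
      by (intro continuous_map_pairedI continuous_map_snd continuous_map_fst_comp[OF 1] continuous_map_snd_comp[OF 1])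
    then show "continuous_map (prod_topology ?EU (subtopology X V))
      (prod_topology (prod_topology (subtopology X U) (subtopology X V)) ?R)
      (\<lambda>(e, b). ((vproj E e, b), snd (\<phi> e)))"
      by (rule continuous_map_eq) (auto simp: top_EU proj simp del: topspace_subtopology)
    have "continuous_map (prod_topology (prod_topology (subtopology X U) (subtopology X V)) ?R)
      (prod_topology ?EU (subtopology X V)) (\<lambda>p. (\<phi>' (fst (fst p), snd p), snd (fst p)))"
      by (intro continuous_map_pairedI continuous_map_compose[OF 2 c', unfolded comp_def]
          continuous_map_snd_comp[OF continuous_map_fst])
    then show "continuous_map (prod_topology (prod_topology (subtopology X U) (subtopology X V)) ?R)
      (prod_topology ?EU (subtopology X V)) (\<lambda>((c, b), x). (\<phi>' (c, x), b))"
      by (simp add: case_prod_unfold)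
  next
    fix p assume "p \<in> topspace (prod_topology ?EU (subtopology X V))"
    then show "(case case p of (e, b) \<Rightarrow> ((vproj E e, b), snd (\<phi> e)) of
        (x, xa) \<Rightarrow> (case x of (c, b) \<Rightarrow> \<lambda>x. (\<phi>' (c, x), b)) xa) = p"
      by (cases p) (auto simp: top_EU proj inv simp del: topspace_subtopology)
  next
    fix q assume "q \<in> topspace (prod_topology (prod_topology (subtopology X U) (subtopology X V)) ?R)"
    then show "(case case q of (x, xa) \<Rightarrow> (case x of (c, b) \<Rightarrow> \<lambda>x. (\<phi>' (c, x), b)) xa of
        (e, b) \<Rightarrow> ((vproj E e, b), snd (\<phi> e))) = q"
      by (auto simp: proj inv')
  qed
  moreover have "linear_map (fibre (bundle_times_base X E) p) (euclidean_module n)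
      (\<lambda>q. snd (case q of (e, b) \<Rightarrow> ((vproj E e, b), snd (\<phi> e))))" if "p \<in> U \<times> V" for p
    using trivialization_linear[OF triv, of "fst p"] that
    by (auto simp: linear_map_def bundle_times_base_def)
  ultimately show ?thesis
    unfolding local_trivialization_def homeomorphic_map_maps
    using U V over by (auto simp: openin_prod_Times_iff bundle_times_base_def subtopology_Times)
qed

text \<open>Counterpart for the second bundle: here the chart of \<open>F\<close> lives over
  \<open>V\<close> and the arbitrary open factor is \<open>U\<close>, so that both trivializations
  share the domain \<open>U \<times> V\<close>.\<close>

lemma trivialization_base_times_bundle:
  assumes triv: "local_trivialization X F V n \<psi>" and U: "openin X U"
  shows "local_trivialization (prod_topology X X) (base_times_bundle X F) (U \<times> V) n
           (\<lambda>(c, y). ((c, vproj F y), snd (\<psi> y)))"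
proof -
  let ?FV = "subtopology (vtop F) (over F V)" and ?R = "Euclidean_space n"
  have V: "openin X V" using triv by (simp add: local_trivialization_def)
  have sub: "U \<subseteq> topspace X" "V \<subseteq> topspace X" using U V by (auto dest: openin_subset)
  obtain \<psi>' where h: "homeomorphic_maps ?FV (prod_topology (subtopology X V) ?R) \<psi> \<psi>'"
    using triv unfolding local_trivialization_def homeomorphic_map_maps by blast
  have c: "continuous_map ?FV (prod_topology (subtopology X V) ?R) \<psi>"
    and c': "continuous_map (prod_topology (subtopology X V) ?R) ?FV \<psi>'"
    using h by (auto simp: homeomorphic_maps_def)
  have top_FV: "topspace ?FV = over F V" by (auto simp: over_def)
  have "\<forall>y\<in>over F V. \<psi>' (\<psi> y) = y"
    and "\<forall>p\<in>V \<times> topspace ?R. \<psi> (\<psi>' p) = p"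
    and "\<psi>' ` (V \<times> topspace ?R) \<subseteq> over F V"
    using h sub continuous_map_image_subset_topspace[OF c']
    unfolding homeomorphic_maps_def top_FV by (simp_all add: inf.absorb2)
  then have inv: "\<And>y. y \<in> over F V \<Longrightarrow> \<psi>' (\<psi> y) = y"
    and inv': "\<And>b x. b \<in> V \<Longrightarrow> x \<in> topspace ?R \<Longrightarrow> \<psi> (\<psi>' (b, x)) = (b, x)"
      "\<And>b x. b \<in> V \<Longrightarrow> x \<in> topspace ?R \<Longrightarrow> \<psi>' (b, x) \<in> over F V"
    by auto
  have proj: "vproj F y = fst (\<psi> y)" if "y \<in> over F V" for y
    using trivialization_fst[OF triv that] by simp
  have over: "over (base_times_bundle X F) (U \<times> V) = U \<times> over F V"
    using sub by (auto simp: over_def base_times_bundle_def)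
  have "homeomorphic_maps (prod_topology (subtopology X U) ?FV)
      (prod_topology (prod_topology (subtopology X U) (subtopology X V)) ?R)
      (\<lambda>(c, y). ((c, vproj F y), snd (\<psi> y))) (\<lambda>((c, b), x). (c, \<psi>' (b, x)))"
    unfolding homeomorphic_maps_def
  proof (intro conjI ballI)
    have 1: "continuous_map (prod_topology (subtopology X U) ?FV) (prod_topology (subtopology X V) ?R) (\<lambda>p. \<psi> (snd p))"
      using continuous_map_compose[OF continuous_map_snd c] by (simp add: comp_def)
    have 2: "continuous_map (prod_topology (prod_topology (subtopology X U) (subtopology X V)) ?R)
        (prod_topology (subtopology X V) ?R) (\<lambda>p. (snd (fst p), snd p))"
      by (intro continuous_map_pairedI continuous_map_snd continuous_map_snd_comp[OF continuous_map_fst])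
    have "continuous_map (prod_topology (subtopology X U) ?FV)
      (prod_topology (prod_topology (subtopology X U) (subtopology X V)) ?R)
      (\<lambda>p. ((fst p, fst (\<psi> (snd p))), snd (\<psi> (snd p))))"
      by (intro continuous_map_pairedI continuous_map_fst continuous_map_fst_comp[OF 1] continuous_map_snd_comp[OF 1])
    then show "continuous_map (prod_topology (subtopology X U) ?FV)
      (prod_topology (prod_topology (subtopology X U) (subtopology X V)) ?R)
      (\<lambda>(c, y). ((c, vproj F y), snd (\<psi> y)))"
      by (rule continuous_map_eq) (auto simp: top_FV proj simp del: topspace_subtopology)
    have "continuous_map (prod_topology (prod_topology (subtopology X U) (subtopology X V)) ?R)
      (prod_topology (subtopology X U) ?FV) (\<lambda>p. (fst (fst p), \<psi>' (snd (fst p), snd p)))"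
      by (intro continuous_map_pairedI continuous_map_compose[OF 2 c', unfolded comp_def]
          continuous_map_fst_comp[OF continuous_map_fst])
    then show "continuous_map (prod_topology (prod_topology (subtopology X U) (subtopology X V)) ?R)
      (prod_topology (subtopology X U) ?FV) (\<lambda>((c, b), x). (c, \<psi>' (b, x)))"
      by (simp add: case_prod_unfold)
  next
    fix p assume "p \<in> topspace (prod_topology (subtopology X U) ?FV)"
    then show "(case case p of (c, y) \<Rightarrow> ((c, vproj F y), snd (\<psi> y)) of
        (x, xa) \<Rightarrow> (case x of (c, b) \<Rightarrow> \<lambda>x. (c, \<psi>' (b, x))) xa) = p"
      by (cases p) (auto simp: top_FV proj inv simp del: topspace_subtopology)
  next
    fix q assume "q \<in> topspace (prod_topology (prod_topology (subtopology X U) (subtopology X V)) ?R)"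
    then show "(case case q of (x, xa) \<Rightarrow> (case x of (c, b) \<Rightarrow> \<lambda>x. (c, \<psi>' (b, x))) xa of
        (c, y) \<Rightarrow> ((c, vproj F y), snd (\<psi> y))) = q"
      by (auto simp: proj inv')
  qed
  moreover have "linear_map (fibre (base_times_bundle X F) p) (euclidean_module n)
      (\<lambda>q. snd (case q of (c, y) \<Rightarrow> ((c, vproj F y), snd (\<psi> y))))" if "p \<in> U \<times> V" for p
    using trivialization_linear[OF triv, of "snd p"] that
    by (auto simp: linear_map_def base_times_bundle_def)
  ultimately show ?thesis
    unfolding local_trivialization_def homeomorphic_map_maps
    using U V over by (auto simp: openin_prod_Times_iff base_times_bundle_def subtopology_Times)
qed

text \<open>True by construction: preimages of open sets under charts are the generators of the
  topology of the Hom bundle.\<close>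

lemma hom_chart_continuous:
  assumes "local_trivialization X V U m \<phi>" "local_trivialization X W U n \<psi>"
  shows "continuous_map (subtopology (vtop (hom_bundle X V W)) {p. fst p \<in> U})
           (prod_topology (subtopology X U) (powertop_real ({..<n} \<times> {..<m}))) (hom_chart V U m \<phi> n \<psi>)"
    (is "continuous_map (subtopology ?H ?P) ?Y ?h")
proof -
  have H: "topspace ?H \<subseteq> hom_points X V W" by (auto simp: hom_bundle_def)
  have U: "U \<subseteq> topspace X" using assms(1) by (auto simp: local_trivialization_def dest: openin_subset)
  have op: "openin ?H {p \<in> hom_points X V W. fst p \<in> U \<and> ?h p \<in> S}" if "openin ?Y S" for S
    unfolding hom_bundle_def vbundle.simps using assms that by (intro topology_generated_by_Basis) blast
  show ?thesis
    unfolding continuous_map_def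
  proof (intro conjI allI impI)
    show "?h \<in> topspace (subtopology ?H ?P) \<rightarrow> topspace ?Y"
    proof
      fix p assume "p \<in> topspace (subtopology ?H ?P)"
      then have "fst p \<in> U" by simp
      then show "?h p \<in> topspace ?Y"
        using U by (cases p) (auto simp: hom_chart_def)
    qed
    fix S assume S: "openin ?Y S"
    \<comment> \<open>The generator ranges over all of \<open>hom_points\<close>, the preimage only
      over points of the generated space. \<open>H\<close> gives one inclusion, openness of the
      generator the other.\<close>
    have "{p \<in> topspace (subtopology ?H ?P). ?h p \<in> S} = {p \<in> hom_points X V W. fst p \<in> U \<and> ?h p \<in> S} \<inter> ?P"
      using H openin_subset[OF op[OF S]] by auto
    then show "openin (subtopology ?H ?P) {p \<in> topspace (subtopology ?H ?P). ?h p \<in> S}"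
      using op[OF S] by (auto simp: openin_subtopology)
  qed
qed

section \<open>Kernels on orbits\<close>

text \<open>The hypothesis on \<kappa> concerns a map into the total space of a bundle over
  \<open>B \<times> B\<close>. Restricting it to the slice of pairs \<open>(c, b)\<close> with
  \<open>b\<close> fixed and reading it in a chart over \<open>U \<times> V\<close> turns it into
  continuity of real functions.\<close>

lemma kernel_matrix_continuous:
  assumes \<kappa>: "continuous_map (subtopology (prod_topology X X) (orbit_pairs G X \<alpha>))
      (vtop (hom_bundle (prod_topology X X) (bundle_times_base X E) (base_times_bundle X F)))
      (kernel_point X E \<kappa>)"
    and trivE: "local_trivialization X E U m \<phi>" and trivF: "local_trivialization X F V n \<psi>"
    and b: "b \<in> V" and ij: "i < n" "j < m"
  shows "continuous_map (subtopology X (orbit G \<alpha> b \<inter> U)) euclideanreal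
           (\<lambda>c. snd (\<psi> (\<kappa> c b (frame E U \<phi> c j))) i)"
proof -
  let ?XX = "prod_topology X X" and ?S = "subtopology X (orbit G \<alpha> b \<inter> U)"
  let ?E = "bundle_times_base X E" and ?F = "base_times_bundle X F"
  let ?\<phi> = "\<lambda>(e, b). ((vproj E e, b), snd (\<phi> e))" and ?\<psi> = "\<lambda>(c, y). ((c, vproj F y), snd (\<psi> y))"
  let ?H = "vtop (hom_bundle ?XX ?E ?F)" and ?chart = "hom_chart ?E (U \<times> V) m ?\<phi> n ?\<psi>"
  have U: "openin X U" and V: "openin X V"
    using trivE trivF by (auto simp: local_trivialization_def)
  have bX: "b \<in> topspace X" using V b by (auto dest: openin_subset)
  have tE: "local_trivialization ?XX ?E (U \<times> V) m ?\<phi>"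
    by (rule trivialization_bundle_times_base[OF trivE V])
  have tF: "local_trivialization ?XX ?F (U \<times> V) n ?\<psi>"
    by (rule trivialization_base_times_bundle[OF trivF U])
  have inS: "c \<in> topspace X" "c \<in> orbit G \<alpha> b" "c \<in> U" if "c \<in> topspace ?S" for c
    using that by auto
  have "continuous_map ?S ?XX (\<lambda>c. (c, b))"
    by (intro continuous_map_pairedI continuous_map_from_subtopology) (auto simp: bX)
  then have "continuous_map ?S (subtopology ?XX (orbit_pairs G X \<alpha>)) (\<lambda>c. (c, b))"
    using bX by (auto simp: continuous_map_in_subtopology orbit_pairs_def)
  from continuous_map_compose[OF this \<kappa>]
  have "continuous_map ?S ?H (\<lambda>c. kernel_point X E \<kappa> (c, b))" by (simp add: comp_def)
  then have "continuous_map ?S (subtopology ?H {p. fst p \<in> U \<times> V}) (\<lambda>c. kernel_point X E \<kappa> (c, b))"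
    unfolding continuous_map_in_subtopology using b by (auto simp: kernel_point_def)
  from continuous_map_compose[OF this hom_chart_continuous[OF tE tF]]
  have "continuous_map ?S (powertop_real ({..<n} \<times> {..<m}))
      (\<lambda>c. snd (?chart (kernel_point X E \<kappa> (c, b))))"
    unfolding comp_def by (rule continuous_map_snd_comp)
  then have "continuous_map ?S euclideanreal (\<lambda>c. snd (?chart (kernel_point X E \<kappa> (c, b))) (i, j))"
    using continuous_map_compose[OF _ continuous_map_product_projection, of ?S _ _ _ "(i, j)"] ij
    by (auto simp: comp_def)
  then show ?thesis
  proof (rule continuous_map_eq)
    fix c assume "c \<in> topspace ?S"
    note c = inS[OF this]
    note frame = frame_carrier[OF trivE c(3) ij(2)]
    \<comment> \<open>The frame vectors of \<open>E \<times> B\<close> over \<open>(c, b)\<close>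
      are those of \<open>E\<close> over \<open>c\<close> paired with \<open>b\<close>.\<close>
    have "inv_into (over ?E (U \<times> V)) ?\<phi> ((c, b), unit_vector j) = (frame E U \<phi> c j, b)"
    proof (rule inv_into_f_eq)
      show "inj_on ?\<phi> (over ?E (U \<times> V))"
        using trivialization_bij_betw[OF tE] by (simp add: bij_betw_def)
      show "(frame E U \<phi> c j, b) \<in> over ?E (U \<times> V)"
        using frame c b bX by (simp add: over_def bundle_times_base_def)
      show "?\<phi> (frame E U \<phi> c j, b) = ((c, b), unit_vector j)"
        using frame trivialization_inv(2)[OF trivE c(3) unit_vector_Euclidean[OF ij(2)]]
        by (simp add: frame_def)
    qed
    \<comment> \<open>\<open>kernel_point\<close> is restricted to the fibre over
      \<open>(c, b)\<close>, so this membership is what allows it to be evaluated.\<close>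
    moreover have "(frame E U \<phi> c j, b) \<in> carrier (fibre ?E (c, b))"
      using frame bX by (simp add: bundle_times_base_def)
    ultimately show "snd (?chart (kernel_point X E \<kappa> (c, b))) (i, j)
        = snd (\<psi> (\<kappa> c b (frame E U \<phi> c j))) i"
      using ij by (simp add: hom_chart_def kernel_point_def unit_vector_def del: fibre_simps)
  qed
qed

lemma continuous_map_locally:
  assumes "\<And>x. x \<in> topspace X \<Longrightarrow> \<exists>U. openin X U \<and> x \<in> U \<and> continuous_map (subtopology X U) Y f"
  shows "continuous_map X Y f"
proof (rule pasting_lemma)
  show "openin X U" "continuous_map (subtopology X U) Y f"
    if "U \<in> {U. openin X U \<and> continuous_map (subtopology X U) Y f}" for U
    using that by auto
qed (use assms in auto)

lemma topspace_orbit_topology: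
  assumes "group_action G (topspace X) \<alpha>" "b \<in> topspace X"
  shows "orbit G \<alpha> b \<subseteq> topspace X" "topspace (orbit_topology G X \<alpha> b) = orbit G \<alpha> b"
proof -
  show "orbit G \<alpha> b \<subseteq> topspace X"
    using group_action.element_image[OF assms(1) _ assms(2)] by (auto simp: orbit_def)
  then show "topspace (orbit_topology G X \<alpha> b) = orbit G \<alpha> b"
    by (auto simp: orbit_topology_def)
qed

text \<open>Near a point of the orbit, \<open>l (\<kappa> c b (f c))\<close> is a sum of products of coordinates of \<open>f c\<close>,
  matrix entries of \<open>\<kappa> c b\<close> in the charts of the Hom bundle, and constants.\<close>

lemma kernel_section_continuous:
  assumes action: "group_action G (topspace X) \<alpha>"
    and E: "vector_bundle X E" and F: "vector_bundle X F" and \<kappa>: "orbit_kernel G X \<alpha> E F \<kappa>"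
    and f: "f \<in> continuous_sections X E" and b: "b \<in> topspace X"
    and l: "linear_map (fibre F b) real_line l"
  shows "continuous_map (orbit_topology G X \<alpha> b) euclideanreal (\<lambda>c. l (\<kappa> c b (f c)))"
proof (rule continuous_map_locally)
  fix c0 assume "c0 \<in> topspace (orbit_topology G X \<alpha> b)"
  then have c0: "c0 \<in> orbit G \<alpha> b" "c0 \<in> topspace X"
    using topspace_orbit_topology[OF action b] by auto
  obtain U m \<phi> where U: "c0 \<in> U" and trivE: "local_trivialization X E U m \<phi>"
    using E c0(2) unfolding vector_bundle_def by meson
  obtain V n \<psi> where V: "b \<in> V" and trivF: "local_trivialization X F V n \<psi>"
    using F b unfolding vector_bundle_def by meson
  let ?O = "orbit G \<alpha> b"
  let ?S = "subtopology X (?O \<inter> U)"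
  have opU: "openin X U" using trivE by (simp add: local_trivialization_def)
  have fcont: "continuous_map X (vtop E) f"
    using f by (auto simp: continuous_sections_def)
  have fE: "f c \<in> carrier (fibre E c)" if "c \<in> topspace X" for c
    using f that by (auto simp: continuous_sections_def all_sections_def)
  have lin: "linear_map (fibre E c) (fibre F b) (\<kappa> c b)" if "c \<in> topspace ?S" for c
    using \<kappa> b that by (auto simp: orbit_kernel_def orbit_pairs_def)
  have "continuous_map ?S (subtopology (vtop E) (over E U)) f"
    using fcont fE by (auto simp: continuous_map_in_subtopology continuous_map_from_subtopology over_def)
  from continuous_map_compose[OF this trivialization_continuous[OF trivE]]
  have "continuous_map ?S (powertop_real UNIV) (\<lambda>c. snd (\<phi> (f c)))"
    unfolding Euclidean_space_def continuous_map_in_subtopology comp_def by blast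
  then have coeff: "continuous_map ?S euclideanreal (\<lambda>c. snd (\<phi> (f c)) j)" for j
    by (simp add: continuous_map_componentwise_UNIV)
  have matrix: "continuous_map ?S euclideanreal (\<lambda>c. snd (\<psi> (\<kappa> c b (frame E U \<phi> c j))) i)"
    if "i < n" "j < m" for i j
    using kernel_matrix_continuous[OF _ trivE trivF V that] \<kappa> by (auto simp: orbit_kernel_def)
  have "continuous_map ?S euclideanreal (\<lambda>c. \<Sum>i<n.
      (\<Sum>j<m. snd (\<phi> (f c)) j * snd (\<psi> (\<kappa> c b (frame E U \<phi> c j))) i) * l (frame F V \<psi> b i))"
    by (intro continuous_map_sum continuous_map_real_mult coeff matrix) auto
  then have "continuous_map ?S euclideanreal (\<lambda>c. l (\<kappa> c b (f c)))"
  proof (rule continuous_map_eq)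
    fix c assume c: "c \<in> topspace ?S"
    then have cU: "c \<in> U" "c \<in> topspace X" by auto
    \<comment> \<open>A coordinate of \<psi> after \<open>\<kappa> c b\<close> is a linear
      functional on the fibre of \<open>E\<close> over \<open>c\<close>, so it expands in the frame
      of \<open>E\<close>. The next step expands \<open>l\<close> in the frame of
      \<open>F\<close>.\<close>
    have "snd (\<psi> (\<kappa> c b (f c))) i = (\<Sum>j<m. snd (\<phi> (f c)) j * snd (\<psi> (\<kappa> c b (frame E U \<phi> c j))) i)" for i
      using linear_functional_frame[OF vector_bundle_fibre(1)[OF E cU(2)] trivE cU(1)
          linear_map_compose[OF lin[OF c] linear_coordinate[OF trivialization_linear[OF trivF V], of i]] fE[OF cU(2)]] .
    moreover have "l (\<kappa> c b (f c)) = (\<Sum>i<n. snd (\<psi> (\<kappa> c b (f c))) i * l (frame F V \<psi> b i))"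
      using linear_functional_frame[OF vector_bundle_fibre(1)[OF F b] trivF V l
          linear_map_closed[OF lin[OF c] fE[OF cU(2)]]] .
    ultimately show "(\<Sum>i<n. (\<Sum>j<m. snd (\<phi> (f c)) j * snd (\<psi> (\<kappa> c b (frame E U \<phi> c j))) i) * l (frame F V \<psi> b i))
        = l (\<kappa> c b (f c))" by simp
  qed
  moreover have "subtopology (orbit_topology G X \<alpha> b) (?O \<inter> U) = ?S"
    by (simp add: orbit_topology_def subtopology_subtopology Int_left_absorb)
  moreover have "openin (orbit_topology G X \<alpha> b) (?O \<inter> U)"
    using opU by (auto simp: orbit_topology_def openin_subtopology)
  ultimately show "\<exists>W. openin (orbit_topology G X \<alpha> b) W \<and> c0 \<in> W \<and>
      continuous_map (subtopology (orbit_topology G X \<alpha> b) W) euclideanreal (\<lambda>c. l (\<kappa> c b (f c)))"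
    using c0 U by (intro exI[of _ "?O \<inter> U"]) auto
qed

text \<open>The transform is defined by a definite description; this shows that its values really
  are integrals. Outside the support of the kernel, \<open>\<kappa> c b\<close> kills every vector
  and in particular \<open>f c\<close>, so every functional of the integrand has compact support in
  the orbit.\<close>

lemma has_vector_integral_kernel:
  assumes action: "group_action G (topspace X) \<alpha>"
    and E: "vector_bundle X E" and F: "vector_bundle X F" and \<kappa>: "orbit_kernel G X \<alpha> E F \<kappa>"
    and \<mu>: "equivariant_orbit_measures G X \<alpha> \<mu>"
    and f: "f \<in> continuous_sections X E" and b: "b \<in> topspace X"
  shows "has_vector_integral (\<mu> b) (fibre F b) (\<lambda>c. \<kappa> c b (f c)) (integral_transform X F \<mu> \<kappa> f b)"
proof -
  let ?X = "orbit_topology G X \<alpha> b"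
  let ?K = "?X closure_of {c \<in> orbit G \<alpha> b. \<exists>v\<in>carrier (fibre E c). \<kappa> c b v \<noteq> vzero F b}"
  note top = topspace_orbit_topology[OF action b]
  have M: "locally_finite_borel_measure ?X (\<mu> b)"
    using \<mu> b by (simp add: equivariant_orbit_measures_def)
  then have space: "space (\<mu> b) = orbit G \<alpha> b"
    using sets_eq_imp_space_eq[of "\<mu> b" "borel_of ?X"] top by (simp add: locally_finite_borel_measure_def)
  have fE: "f c \<in> carrier (fibre E c)" if "c \<in> orbit G \<alpha> b" for c
    using f that top by (auto simp: continuous_sections_def all_sections_def)
  have lin: "linear_map (fibre E c) (fibre F b) (\<kappa> c b)" if "c \<in> orbit G \<alpha> b" for c
    using \<kappa> b that top by (auto simp: orbit_kernel_def orbit_pairs_def)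
  have "has_vector_integral (\<mu> b) (fibre F b) (\<lambda>c. \<kappa> c b (f c)) (vector_integral (\<mu> b) (fibre F b) (\<lambda>c. \<kappa> c b (f c)))"
  proof (rule has_vector_integral_exists[OF vector_bundle_fibre(2)[OF F b]])
    show "(\<lambda>c. \<kappa> c b (f c)) \<in> space (\<mu> b) \<rightarrow> carrier (fibre F b)"
      using linear_map_closed[OF lin fE] space by blast
    fix l assume l: "linear_map (fibre F b) real_line l"
    show "integrable (\<mu> b) (\<lambda>c. l (\<kappa> c b (f c)))"
    proof (rule integrable_continuous_compact_support[OF M kernel_section_continuous[OF action E F \<kappa> f b l]])
      show "compactin ?X ?K" using \<kappa> b by (simp add: orbit_kernel_def)
      show "closedin ?X ?K" by simp
      fix c assume c: "c \<in> topspace ?X - ?K"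
      then have "\<kappa> c b (f c) = vzero F b"
        using fE[of c] top closure_of_subset[of "{c \<in> orbit G \<alpha> b. \<exists>v\<in>carrier (fibre E c). \<kappa> c b v \<noteq> vzero F b}" ?X]
        by blast
      then show "l (\<kappa> c b (f c)) = 0"
        using linear_functional_zero[OF vector_bundle_fibre(1)[OF F b] l] by simp
    qed
  qed
  then show ?thesis using b by (simp add: integral_transform_def)
qed

section \<open>Continuity of translations on sections and orbits\<close>

lemma continuous_action_map:
  assumes "continuous_action G T X \<alpha>" "topspace T = carrier G" "g \<in> carrier G"
  shows "continuous_map X X (\<alpha> g)"
proof -
  have "continuous_map X (prod_topology T X) (\<lambda>x. (g, x))"
    using assms by (intro continuous_map_pairedI) auto
  from continuous_map_compose[OF this, of X "\<lambda>(g, x). \<alpha> g x"] show ?thesis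
    using assms(1) by (simp add: continuous_action_def comp_def)
qed

text \<open>Existence of the integral is established for continuous sections, so the translated
  section must be one as well. It is a composition of three continuous maps, and
  \<open>\<rho> g\<close> carries the fibre over the translate of \<open>b\<close> by the inverse of
  \<open>g\<close> back to the fibre over \<open>b\<close>.\<close>

lemma section_action_continuous:
  assumes G: "topological_group G T" and action: "continuous_action G T X \<alpha>"
    and E: "equivariant_vector_bundle G T X \<alpha> E \<rho>"
    and g: "g \<in> carrier G" and f: "f \<in> continuous_sections X E"
  shows "section_action G X \<alpha> \<rho> g f \<in> continuous_sections X E"
proof -
  interpret topological_group G T by (rule G)
  have act: "group_action G (topspace X) \<alpha>" using action by (simp add: continuous_action_def)
  have inv: "\<alpha> (inv\<^bsub>G\<^esub> g) b \<in> topspace X" "\<alpha> g (\<alpha> (inv\<^bsub>G\<^esub> g) b) = b" if "b \<in> topspace X" for b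
    using group_action.element_image[OF act _ that] g
      group_action.orbit_sym_aux[OF act inv_closed[OF g] that refl] by auto
  have f': "continuous_map X (vtop E) f" "\<And>c. c \<in> topspace X \<Longrightarrow> f c \<in> carrier (fibre E c)"
    using f by (auto simp: continuous_sections_def all_sections_def)
  have \<rho>: "continuous_action G T (vtop E) \<rho>"
      "\<And>b. b \<in> topspace X \<Longrightarrow> linear_map (fibre E b) (fibre E (\<alpha> g b)) (\<rho> g)"
    using E g by (auto simp: equivariant_vector_bundle_def)
  have "\<rho> g (f (\<alpha> (inv\<^bsub>G\<^esub> g) b)) \<in> carrier (fibre E b)" if "b \<in> topspace X" for b
    using linear_map_closed[OF \<rho>(2)[OF inv(1)[OF that]] f'(2)[OF inv(1)[OF that]]] inv(2)[OF that] by simp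
  then have "section_action G X \<alpha> \<rho> g f \<in> all_sections X E"
    by (simp add: all_sections_def section_action_def)
  moreover have "continuous_map X (vtop E) (\<lambda>b. \<rho> g (f (\<alpha> (inv\<^bsub>G\<^esub> g) b)))"
    using continuous_map_compose[OF continuous_map_compose[OF
          continuous_action_map[OF action topspace_eq inv_closed[OF g]] f'(1)]
        continuous_action_map[OF \<rho>(1) topspace_eq g]]
    by (simp add: comp_def)
  then have "continuous_map X (vtop E) (section_action G X \<alpha> \<rho> g f)"
    by (rule continuous_map_eq) (simp add: section_action_def)
  ultimately show ?thesis by (simp add: continuous_sections_def)
qed

text \<open>Provides the Borel measurability of the translation between two orbits that the change
  of variables requires.\<close>

lemma orbit_translate:
  assumes G: "topological_group G T" and action: "continuous_action G T X \<alpha>"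
    and g: "g \<in> carrier G" and b: "b \<in> topspace X"
  shows "continuous_map (orbit_topology G X \<alpha> b) (orbit_topology G X \<alpha> (\<alpha> g b)) (\<alpha> g)"
proof -
  interpret topological_group G T by (rule G)
  have act: "group_action G (topspace X) \<alpha>" using action by (simp add: continuous_action_def)
  have "\<alpha> g c \<in> orbit G \<alpha> (\<alpha> g b)" if "c \<in> orbit G \<alpha> b" for c
  proof -
    obtain h where h: "h \<in> carrier G" "c = \<alpha> h b" using \<open>c \<in> orbit G \<alpha> b\<close> by (auto simp: orbit_def)
    \<comment> \<open>The conjugate of \<open>h\<close> by \<open>g\<close> moves
      \<open>\<alpha> g b\<close> to the translate of \<open>\<alpha> h b\<close> by
      \<open>g\<close>, which witnesses membership in the orbit.\<close>
    have "\<alpha> (g \<otimes>\<^bsub>G\<^esub> h \<otimes>\<^bsub>G\<^esub> inv\<^bsub>G\<^esub> g) (\<alpha> g b) = \<alpha> (g \<otimes>\<^bsub>G\<^esub> h \<otimes>\<^bsub>G\<^esub> inv\<^bsub>G\<^esub> g \<otimes>\<^bsub>G\<^esub> g) b"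
      using g h b by (subst (2) group_action.composition_rule[OF act]) auto
    also have "\<dots> = \<alpha> g c"
      using g h b by (simp add: m_assoc group_action.composition_rule[OF act])
    finally show ?thesis using g h unfolding orbit_def by (auto intro!: exI[of _ "g \<otimes>\<^bsub>G\<^esub> h \<otimes>\<^bsub>G\<^esub> inv\<^bsub>G\<^esub> g"])
  qed
  then show ?thesis
    using continuous_action_map[OF action topspace_eq g]
    by (auto simp: orbit_topology_def continuous_map_in_subtopology continuous_map_from_subtopology)
qed

section \<open>Equivariance of the transform\<close>

theorem lemma3p1:
  fixes G :: "('g, 'm) monoid_scheme" and T :: "'g topology"
    and B :: "'b topology" and act :: "'g \<Rightarrow> 'b \<Rightarrow> 'b"
    and E :: "('b, 'e) vbundle" and actE :: "'g \<Rightarrow> 'e \<Rightarrow> 'e"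
    and F :: "('b, 'f) vbundle" and actF :: "'g \<Rightarrow> 'f \<Rightarrow> 'f"
    and \<mu> :: "'b \<Rightarrow> 'b measure"
    and \<kappa> :: "'b \<Rightarrow> 'b \<Rightarrow> 'e \<Rightarrow> 'f"
  assumes "topological_group G T" and "Hausdorff_space T"
    and "Hausdorff_space B" and "continuous_action G T B act"
    and "equivariant_vector_bundle G T B act E actE"
    and "equivariant_vector_bundle G T B act F actF"
    and "equivariant_orbit_measures G B act \<mu>"
    and "orbit_kernel G B act E F \<kappa>"
    and "\<And>g b c v. \<lbrakk>g \<in> carrier G; b \<in> topspace B; c \<in> orbit G act b; v \<in> carrier (fibre E c)\<rbrakk>
           \<Longrightarrow> actF g (\<kappa> c b v) = \<kappa> (act g c) (act g b) (actE g v)"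
  shows "equivariant_map G (section_action G B act actE) (continuous_sections B E)
           (section_action G B act actF) (all_sections B F) (integral_transform B F \<mu> \<kappa>)"
proof -
  interpret topological_group G T by (rule assms(1))
  let ?I = "integral_transform B F \<mu> \<kappa>"
  have action: "group_action G (topspace B) act"
    using assms(4) by (simp add: continuous_action_def)
  have E: "vector_bundle B E" and F: "vector_bundle B F"
    using assms(5,6) by (auto simp: equivariant_vector_bundle_def)
  note integral = has_vector_integral_kernel[OF action E F assms(8,7)]
  have "?I f \<in> all_sections B F" if "f \<in> continuous_sections B E" for f
    using integral[OF that]
    by (auto simp: all_sections_def has_vector_integral_def integral_transform_def[of B F \<mu> \<kappa> f]
        simp del: fibre_simps)
  moreover have "?I (section_action G B act actE g f) = section_action G B act actF g (?I f)"
    if g: "g \<in> carrier G" and f: "f \<in> continuous_sections B E" for g f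
  proof
    fix b
    let ?gf = "section_action G B act actE g f"
    show "?I ?gf b = section_action G B act actF g (?I f) b"
    proof (cases "b \<in> topspace B")
      \<comment> \<open>Both sides are restricted to the base, hence \<open>undefined\<close>
        here.\<close>
      case False
      then show ?thesis by (simp add: integral_transform_def section_action_def)
    next
      case True
      \<comment> \<open>With \<open>b\<close> written as the translate of \<open>a\<close>, the
        measure at \<open>b\<close> is the pushforward of the one at \<open>a\<close>.\<close>
      define a where "a = act (inv\<^bsub>G\<^esub> g) b"
      have a: "a \<in> topspace B" "act g a = b"
        using group_action.element_image[OF action _ True] g
          group_action.orbit_sym_aux[OF action inv_closed[OF g] True refl] by (auto simp: a_def)
      let ?N = "borel_of (orbit_topology G B act b)"
      have distr: "\<mu> b = distr (\<mu> a) ?N (act g)"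
        using assms(7) g a by (auto simp: equivariant_orbit_measures_def)
      have sets: "sets (\<mu> a) = sets (borel_of (orbit_topology G B act a))"
        using assms(7) a by (simp add: equivariant_orbit_measures_def locally_finite_borel_measure_def)
      then have space: "space (\<mu> a) = orbit G act a"
        using sets_eq_imp_space_eq[OF sets] topspace_orbit_topology[OF action a(1)] by simp
      have meas: "act g \<in> measurable (\<mu> a) ?N"
        using measurable_borel_of[OF orbit_translate[OF assms(1,4) g a(1)]] a(2)
        by (simp add: measurable_cong_sets[OF sets refl])
      have "has_vector_integral (\<mu> a) (fibre F b) (\<lambda>c. \<kappa> (act g c) b (?gf (act g c))) (?I ?gf b)"
        using integral[OF section_action_continuous[OF assms(1,4,5) g f] True]
        unfolding distr by (rule has_vector_integral_distr[OF meas])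
      then have "has_vector_integral (\<mu> a) (fibre F b) (\<lambda>c. actF g (\<kappa> c a (f c))) (?I ?gf b)"
      proof (rule has_vector_integral_cong)
        fix c assume "c \<in> space (\<mu> a)"
        then have c: "c \<in> orbit G act a" "c \<in> topspace B"
          using space topspace_orbit_topology(1)[OF action a(1)] by auto
        \<comment> \<open>The inverse of \<open>g\<close> inside the section action cancels the
          substitution, and equivariance of \<kappa> then takes \<open>g\<close> outside.\<close>
        have "?gf (act g c) = actE g (f c)"
          using group_action.element_image[OF action g c(2)]
            group_action.orbit_sym_aux[OF action g c(2) refl] by (simp add: section_action_def)
        moreover have "f c \<in> carrier (fibre E c)"
          using f c(2) by (auto simp: continuous_sections_def all_sections_def)
        ultimately show "\<kappa> (act g c) b (?gf (act g c)) = actF g (\<kappa> c a (f c))"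
          using assms(9)[OF g a(1) c(1)] a(2) by simp
      qed
      moreover have "linear_map (fibre F a) (fibre F b) (actF g)"
        using assms(6) g a by (auto simp: equivariant_vector_bundle_def)
      then have "has_vector_integral (\<mu> a) (fibre F b) (\<lambda>c. actF g (\<kappa> c a (f c))) (actF g (?I f a))"
        by (rule has_vector_integral_linear[OF integral[OF f a(1)]])
      \<comment> \<open>Both sides are integrals over \<open>\<mu> a\<close> of one and the same
        function into the fibre of \<open>F\<close> over \<open>b\<close>.\<close>
      ultimately have "?I ?gf b = actF g (?I f a)"
        by (rule has_vector_integral_unique[OF vector_bundle_fibre(2)[OF F True]])
      then show ?thesis using True by (simp add: section_action_def a_def)
    qed
  qed
  ultimately show ?thesis by (auto simp: equivariant_map_def)
qed

end
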